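(* Let $G$ be a connected graph of order $n=|V(G)|\ge 2$ with exactly $k\ge 1$ min-forced vertices. Then $$k\le \frac{2}{3}\left(n-\gamma^{LD}(G)\right)\quad\text{and}\quad k\le \frac{2}{5}n.$$ Moreover, there exist such graphs for which the equalities $k=\frac23\left(n-\gamma^{LD}(G)\right)$ and $k=\frac25 n$ hold. In particular, the maximum, over all connected graphs of order at least $2$, of the ratio between the number of min-forced vertices and the order of the graph is $\frac{2}{5}$.
   Context: All graphs are simple, finite and undirected. $N_G[v]$ denotes the closed neighbourhood of $v$, i.e. $v$ together with its neighbours. For $S\subseteq V(G)$ and $v\in V(G)$ put $I_G(S;v)=S\cap N_G[v]$. A nonempty set $S\subseteq V(G)$ is a locating-dominating code (LD-code) if for all distinct $x,y\in V(G)\setminus S$ we have $I_G(S;x)\ne I_G(S;y)$, and $I_G(S;x)\neq\emptyset$ for every $x\in V(G)\setminus S$. $\gamma^{LD}(G)$ is the minimum cardinality of an LD-code in $G$; an LD-code of this cardinality is a minimum LD-code. A vertex $v\in V(G)$ is min-forced if it belongs to every minimum LD-code of $G$. *)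

theory Defs
  imports Complex_Main "Graph_Theory.Graph_Theory"
begin

text \<open>
  A finite simple undirected graph is a \<^locale>\<open>pair_graph\<close>: a finite vertex set together with
  a symmetric, irreflexive set of ordered pairs, so that each undirected edge occurs as both of
  its orientations.  The name \<open>connected\<close> of the graph
  library clashes with the topological constant, hence the qualified name; the graph notion also
  requires a nonempty vertex set.
\<close>

definition connected_graph :: "'a pair_pre_digraph \<Rightarrow> bool" where
  "connected_graph G \<longleftrightarrow> pair_graph G \<and> Digraph_Component.connected (with_proj G)"

definition closed_nbhd :: "'a pair_pre_digraph \<Rightarrow> 'a \<Rightarrow> 'a set" where
  "closed_nbhd G v = insert v {u. (v, u) \<in> parcs G}"

definition I_set :: "'a pair_pre_digraph \<Rightarrow> 'a set \<Rightarrow> 'a \<Rightarrow> 'a set" where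
  "I_set G S v = S \<inter> closed_nbhd G v"

definition LD_code :: "'a pair_pre_digraph \<Rightarrow> 'a set \<Rightarrow> bool" where
  "LD_code G S \<longleftrightarrow> S \<subseteq> pverts G \<and> S \<noteq> {} \<and>
     (\<forall>x \<in> pverts G - S. \<forall>y \<in> pverts G - S. x \<noteq> y \<longrightarrow> I_set G S x \<noteq> I_set G S y) \<and>
     (\<forall>x \<in> pverts G - S. I_set G S x \<noteq> {})"

text \<open>
  The minimum below exists for every graph with a nonempty finite vertex set, since then the
  whole vertex set is an LD-code.
\<close>

definition LD_number :: "'a pair_pre_digraph \<Rightarrow> nat" where
  "LD_number G = (LEAST m. \<exists>S. LD_code G S \<and> card S = m)"

definition minimum_LD_code :: "'a pair_pre_digraph \<Rightarrow> 'a set \<Rightarrow> bool" where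
  "minimum_LD_code G S \<longleftrightarrow> LD_code G S \<and> card S = LD_number G"

definition min_forced :: "'a pair_pre_digraph \<Rightarrow> 'a set" where
  "min_forced G = {v \<in> pverts G. \<forall>S. minimum_LD_code G S \<longrightarrow> v \<in> S}"

definition forced_ratio :: "'a pair_pre_digraph \<Rightarrow> real" where
  "forced_ratio G = real (card (min_forced G)) / real (card (pverts G))"

end

theory Submission
  imports Defs
begin

text \<open>
  Fix a minimum LD-code \<open>S\<close> of size \<open>\<gamma>\<close>.  The traces on \<open>S\<close> of the \<open>n - \<gamma>\<close> vertices outside \<open>S\<close>
  are distinct and nonempty, so together with the empty set they form a family \<open>F\<close> of
  \<open>n - \<gamma> + 1\<close> subsets of \<open>S\<close>, that is, of vertices of the cube on \<open>S\<close>.  An edge of that cube in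
  direction \<open>v\<close> between two members of \<open>F\<close> is a pair of traces that only \<open>v\<close> tells apart.  The empty
  set stands for an artificial vertex without neighbours, which turns domination into one more
  instance of separation.

  If \<open>v\<close> is min-forced, then no exchange of \<open>v\<close> for a vertex \<open>u\<close> outside \<open>S\<close> gives an LD-code.  When
  \<open>F\<close> has at most one edge in direction \<open>v\<close>, removing \<open>v\<close> causes so few collisions of traces that a
  suitable \<open>u\<close> repairs all of them; hence a min-forced \<open>v\<close> is the direction of at least two edges of
  \<open>F\<close> (\<open>min_forced_direction_twice\<close>).

  It remains to bound the number \<open>k\<close> of directions that occur at least twice in a family \<open>F\<close>.  If two
  edges are kept for each such direction, every cycle uses each direction an even number of times, and
  this makes the kept edges a cactus all of whose cycles have length at least four; a cactus of this
  kind on \<open>m\<close> vertices has at most \<open>4 (m - 1) / 3\<close> edges.  So \<open>2 k \<le> 4 (|F| - 1) / 3\<close>, which is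
  \<open>3 k \<le> 2 (n - \<gamma>)\<close>.  The cactus serves as intuition only: \<open>card_single_double_directions\<close> obtains the
  count by contracting one direction at a time.  Since min-forced vertices lie in \<open>S\<close>, also
  \<open>k \<le> \<gamma>\<close>, and the two inequalities give \<open>5 k \<le> 2 n\<close>.  Both bounds are attained by the path on five
  vertices, whose only LD-code of size two consists of the two neighbours of the ends.
\<close>

section \<open>Directions of cube edges in a set family\<close>

text \<open>
  The edges of \<open>F\<close> in direction \<open>v\<close>, each represented by its end that avoids \<open>v\<close>.
\<close>

definition link :: "'c set set \<Rightarrow> 'c \<Rightarrow> 'c set set" where
  "link F v = {A \<in> F. v \<notin> A \<and> insert v A \<in> F}"

text \<open>
  Deleting \<open>v\<close> from all members contracts exactly the edges in direction \<open>v\<close>.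
\<close>

definition contract :: "'c set set \<Rightarrow> 'c \<Rightarrow> 'c set set" where
  "contract F v = (\<lambda>A. A - {v}) ` F"

lemma finite_link: "finite F \<Longrightarrow> finite (link F v)"
  by (simp add: link_def)

lemma finite_contract: "finite F \<Longrightarrow> finite (contract F v)"
  by (simp add: contract_def)

lemma contract_eq_empty_iff: "contract F v = {} \<longleftrightarrow> F = {}"
  by (simp add: contract_def)

lemma link_link_commute: "link (link F v) w = link (link F w) v"
  by (auto simp: link_def insert_commute)

lemma card_contract:
  assumes "finite F"
  shows "card (contract F v) + card (link F v) = card F"
proof -
  define F0 where "F0 = {A \<in> F. v \<notin> A}"
  define F1 where "F1 = {A \<in> F. v \<in> A}"
  define I where "I = (\<lambda>A. A - {v}) ` F1"
  have fin: "finite F0" "finite F1" "finite I"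
    using assms by (auto simp: F0_def F1_def I_def)
  have F: "F = F0 \<union> F1" "F0 \<inter> F1 = {}"
    by (auto simp: F0_def F1_def)
  have "(\<lambda>A. A - {v}) ` F0 = F0"
    by (force simp: F0_def)
  then have contr: "contract F v = F0 \<union> I"
    unfolding contract_def I_def F(1) image_Un by simp
  have link: "link F v = F0 \<inter> I"
  proof
    show "link F v \<subseteq> F0 \<inter> I"
    proof
      fix A assume A: "A \<in> link F v"
      then have "insert v A \<in> F1" "A = insert v A - {v}"
        by (auto simp: link_def F1_def)
      then show "A \<in> F0 \<inter> I"
        using A unfolding I_def link_def F0_def by blast
    qed
    show "F0 \<inter> I \<subseteq> link F v"
      by (auto simp: link_def F0_def F1_def I_def insert_absorb)
  qed
  have "inj_on (\<lambda>A. A - {v}) F1"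
    by (auto simp: inj_on_def F1_def)
  then have "card I = card F1"
    by (simp add: I_def card_image)
  moreover have "card F0 + card I = card (F0 \<union> I) + card (F0 \<inter> I)"
    using fin by (intro card_Un_Int)
  moreover have "card F = card F0 + card F1"
    using F fin by (simp add: card_Un_disjoint)
  ultimately show ?thesis
    by (simp add: contr link)
qed

lemma contract_link_subset:
  assumes "w \<noteq> v"
  shows "contract (link F w) v \<subseteq> link (contract F v) w"
proof
  fix B assume "B \<in> contract (link F w) v"
  then obtain A where A: "A \<in> F" "w \<notin> A" "insert w A \<in> F" and B: "B = A - {v}"
    by (auto simp: contract_def link_def)
  have "insert w B = insert w A - {v}"
    using assms B by auto
  then show "B \<in> link (contract F v) w"
    using A B by (auto simp: contract_def link_def)
qed

text \<open>
  Two edges in direction \<open>w\<close> become equal under contraction of \<open>v\<close> only when they are opposite sides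
  of a square with sides \<open>v\<close> and \<open>w\<close>; such squares are counted by the iterated link.
\<close>

lemma card_link_contract:
  assumes "finite F" "w \<noteq> v"
  shows "card (link F w) \<le> card (link (contract F v) w) + card (link (link F w) v)"
proof -
  have "card (contract (link F w) v) \<le> card (link (contract F v) w)"
    using assms by (intro card_mono finite_link finite_contract contract_link_subset)
  then show ?thesis
    using card_contract[OF finite_link[OF assms(1)], of w v] by linarith
qed

lemma link_contract_nonempty:
  assumes "w \<noteq> v" "link F w \<noteq> {}"
  shows "link (contract F v) w \<noteq> {}"
proof -
  have "contract (link F w) v \<noteq> {}"
    using assms(2) by (simp add: contract_eq_empty_iff)
  then show ?thesis
    using contract_link_subset[OF assms(1), of F] by auto
qed

text \<open>
  Contracting a direction that occurs removes at least one member of the family and no other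
  direction.
\<close>

lemma card_directions_less:
  assumes "finite K" "finite F" "F \<noteq> {}" "\<And>w. w \<in> K \<Longrightarrow> link F w \<noteq> {}"
  shows "card K < card F"
  using assms
proof (induction K arbitrary: F rule: finite_induct)
  case empty
  then show ?case by (simp add: card_gt_0_iff)
next
  case (insert v K)
  have "card K < card (contract F v)"
  proof (rule insert.IH)
    fix w assume "w \<in> K"
    then show "link (contract F v) w \<noteq> {}"
      using insert.hyps insert.prems(3)[of w] link_contract_nonempty[of w v F] by auto
  qed (simp_all add: insert.prems(1,2) finite_contract contract_eq_empty_iff)
  moreover have "card (link F v) \<ge> 1"
    using insert.prems(3)[of v] finite_link[OF insert.prems(1), of v]
    by (simp add: Suc_le_eq card_gt_0_iff)
  ultimately show ?case
    using card_contract[OF insert.prems(1), of v] insert.hyps by simp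
qed

text \<open>
  Contract a direction \<open>v\<close> that occurs at least twice.  A direction \<open>w\<close> that occurs at least twice in
  \<open>F\<close> but only once after the contraction lies in a square with \<open>v\<close>, hence is a direction within
  \<open>link F v\<close>; so fewer than \<open>card (link F v)\<close> directions are lost to the class of single ones.
  This degradation is the reason for carrying the single directions \<open>K\<close>, of weight 2, along with the
  double ones \<open>L\<close>, of weight 3.
\<close>

lemma card_single_double_directions:
  assumes "finite K" "finite L" "K \<inter> L = {}" "finite F" "F \<noteq> {}"
    and "\<And>w. w \<in> K \<Longrightarrow> link F w \<noteq> {}"
    and "\<And>w. w \<in> L \<Longrightarrow> 2 \<le> card (link F w)"
  shows "2 * card K + 3 * card L + 2 \<le> 2 * card F"
  using assms
proof (induction "card L" arbitrary: K L F rule: less_induct)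
  case less
  note fin = \<open>finite K\<close> \<open>finite L\<close> \<open>finite F\<close>
  show ?case
  proof (cases "L = {}")
    case True
    then show ?thesis
      using card_directions_less[OF less.prems(1,4,5,6)] by simp
  next
    case False
    then obtain v where v: "v \<in> L" by blast
    define D where "D = {w \<in> L - {v}. card (link (contract F v) w) < 2}"
    define L' where "L' = L - {v} - D"
    have finD: "finite D" "finite L'" and "D \<subseteq> L - {v}"
      using fin by (auto simp: D_def L'_def)
    have "L' \<subset> L"
      using v by (auto simp: L'_def)
    then have less': "card L' < card L"
      using fin by (intro psubset_card_mono)
    have "card L = card (L - {v}) + 1"
      using v fin by (metis Suc_eq_plus1 card_Suc_Diff1)
    moreover have "card (L - {v}) = card L' + card D"
      using fin finD \<open>D \<subseteq> L - {v}\<close> unfolding L'_def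
      by (simp add: card_Diff_subset card_mono)
    ultimately have cardL: "card L = card L' + card D + 1"
      by simp
    have nonempty: "link F w \<noteq> {}" if "w \<in> K \<union> L" for w
      using that less.prems(6,7)[of w] by fastforce
    \<comment> \<open>If \<open>d\<close> is the cardinality of \<open>D\<close>, the left side drops by \<open>3 + d\<close>, the right side by twice the size
      of the link of \<open>v\<close>.  That size is at least 2 and at least \<open>d + 1\<close>, and the sum of these two
      bounds is \<open>3 + d\<close>.\<close>
    have IH: "2 * card (K \<union> D) + 3 * card L' + 2 \<le> 2 * card (contract F v)"
    proof (rule less.hyps)
      show "(K \<union> D) \<inter> L' = {}"
        using less.prems(3) by (auto simp: L'_def)
      show "link (contract F v) w \<noteq> {}" if "w \<in> K \<union> D" for w
        by (rule link_contract_nonempty) (use that nonempty[of w] v less.prems(3) in \<open>auto simp: D_def\<close>)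
      show "2 \<le> card (link (contract F v) w)" if "w \<in> L'" for w
        using that by (auto simp: L'_def D_def)
    qed (use less' fin finD less.prems(5) in
        \<open>simp_all add: finite_contract contract_eq_empty_iff\<close>)
    have cardKD: "card (K \<union> D) = card K + card D"
      using fin finD less.prems(3) by (intro card_Un_disjoint) (auto simp: D_def)
    have two: "2 \<le> card (link F v)"
      using less.prems(7) v .
    have "card D < card (link F v)"
    proof (rule card_directions_less)
      fix w assume "w \<in> D"
      then have w: "w \<in> L" "w \<noteq> v" "card (link (contract F v) w) < 2"
        by (auto simp: D_def)
      then have "card (link (link F w) v) > 0"
        using card_link_contract[OF fin(3) w(2)] less.prems(7)[OF w(1)] by linarith
      then show "link (link F v) w \<noteq> {}"
        by (auto simp: link_link_commute[of F v])
    qed (use fin finD two in \<open>auto simp: finite_link\<close>)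
    then show ?thesis
      using IH cardKD cardL two card_contract[OF fin(3), of v] by linarith
  qed
qed

section \<open>Traces of the vertices outside a code\<close>

text \<open>
  \<open>None\<close> is an artificial vertex without neighbours: a vertex is dominated exactly when its trace
  differs from that of \<open>None\<close>.
\<close>

definition nbrs :: "'a pair_pre_digraph \<Rightarrow> 'a option \<Rightarrow> 'a set" where
  "nbrs G p = (case p of None \<Rightarrow> {} | Some x \<Rightarrow> {u. (x, u) \<in> parcs G})"

lemma nbrs_simps [simp]: "nbrs G None = {}" "nbrs G (Some x) = {u. (x, u) \<in> parcs G}"
  by (simp_all add: nbrs_def)

definition outside :: "'a pair_pre_digraph \<Rightarrow> 'a set \<Rightarrow> 'a option set" where
  "outside G S = insert None (Some ` (pverts G - S))"

text \<open>
  The artificial vertex has the empty trace, so injectivity covers both separation and domination;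
  it also excludes the empty code, for which every real vertex has the trace of \<open>None\<close>.
\<close>

lemma LD_code_iff_inj_on:
  assumes "pverts G \<noteq> {}"
  shows "LD_code G S \<longleftrightarrow> S \<subseteq> pverts G \<and> inj_on (\<lambda>p. S \<inter> nbrs G p) (outside G S)"
proof -
  have I: "I_set G S x = S \<inter> nbrs G (Some x)" if "x \<notin> S" for x
    using that by (auto simp: I_set_def closed_nbhd_def)
  have nonempty: "S \<noteq> {}" if "inj_on (\<lambda>p. S \<inter> nbrs G p) (outside G S)"
    using that assms by (force simp: outside_def inj_on_def)
  have "inj_on (\<lambda>p. S \<inter> nbrs G p) (outside G S) \<longleftrightarrow>
      inj_on (\<lambda>x. S \<inter> nbrs G (Some x)) (pverts G - S) \<and>
      {} \<notin> (\<lambda>x. S \<inter> nbrs G (Some x)) ` (pverts G - S)"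
    unfolding outside_def by (subst inj_on_insert) (auto simp: inj_on_def simp del: nbrs_simps(2))
  also have "inj_on (\<lambda>x. S \<inter> nbrs G (Some x)) (pverts G - S) \<longleftrightarrow>
      inj_on (I_set G S) (pverts G - S)"
    by (intro inj_on_cong) (simp add: I)
  also have "(\<lambda>x. S \<inter> nbrs G (Some x)) ` (pverts G - S) = I_set G S ` (pverts G - S)"
    by (intro image_cong) (simp_all add: I)
  finally have inj: "inj_on (\<lambda>p. S \<inter> nbrs G p) (outside G S) \<longleftrightarrow>
      inj_on (I_set G S) (pverts G - S) \<and> {} \<notin> I_set G S ` (pverts G - S)" .
  have "LD_code G S \<longleftrightarrow> S \<subseteq> pverts G \<and> S \<noteq> {} \<and>
      inj_on (I_set G S) (pverts G - S) \<and> {} \<notin> I_set G S ` (pverts G - S)"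
    unfolding LD_code_def inj_on_def image_iff by blast
  then show ?thesis
    using nonempty inj by metis
qed

lemma finite_outside: "finite (pverts G) \<Longrightarrow> finite (outside G S)"
  by (simp add: outside_def)

lemma card_outside:
  assumes "finite (pverts G)" "S \<subseteq> pverts G"
  shows "card (outside G S) = card (pverts G) - card S + 1"
  using assms by (simp add: outside_def card_image card_Diff_subset finite_subset)

section \<open>Connected graphs and minimum codes\<close>

lemma connected_graph_iff:
  "connected_graph G \<longleftrightarrow> pair_graph G \<and> pverts G \<noteq> {} \<and>
     (\<forall>u \<in> pverts G. \<forall>v \<in> pverts G. (u, v) \<in> rtrancl_on (pverts G) ((parcs G)\<^sup>s))"
proof -
  have "arcs_ends (with_proj G) = parcs G"
    by (simp add: with_proj_def arcs_ends_def arc_to_ends_def)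
  then show ?thesis
    by (simp add: connected_graph_def connected_conv with_proj_def)
qed

lemma connected_graph_facts:
  assumes "connected_graph G"
  shows "finite (pverts G)" "pverts G \<noteq> {}"
    "(x, y) \<in> parcs G \<longleftrightarrow> (y, x) \<in> parcs G" "(x, x) \<notin> parcs G"
    "(x, y) \<in> parcs G \<Longrightarrow> y \<in> pverts G"
proof -
  interpret pair_graph G
    using assms by (simp add: connected_graph_def)
  show "finite (pverts G)"
    by (rule pair_finite_verts)
  show "pverts G \<noteq> {}"
    using assms by (simp add: connected_graph_iff)
  show "(x, y) \<in> parcs G \<longleftrightarrow> (y, x) \<in> parcs G"
    using pair_sym_arcs by (auto simp: symmetric_def dest: symD)
  show "(x, x) \<notin> parcs G"
    using pair_no_loops by force
  show "y \<in> pverts G" if "(x, y) \<in> parcs G"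
    using that by (rule in_arcsD2)
qed

lemma connected_graph_obtains_neighbour:
  assumes "connected_graph G" "card (pverts G) \<ge> 2" "v \<in> pverts G"
  obtains u where "(v, u) \<in> parcs G"
proof -
  interpret pair_graph G
    using assms by (simp add: connected_graph_def)
  obtain w where w: "w \<in> pverts G" "w \<noteq> v"
    using assms(2) by (metis card_le_Suc0_iff_eq not_less_eq_eq numeral_2_eq_2 pair_finite_verts)
  have "(v, w) \<in> rtrancl_on (pverts G) ((parcs G)\<^sup>s)"
    using assms(1,3) w by (simp add: connected_graph_iff)
  then have "(v, w) \<in> ((parcs G)\<^sup>s)\<^sup>*"
    by (rule rtrancl_on_rtranclI)
  then obtain u where "(v, u) \<in> (parcs G)\<^sup>s"
    using w by (metis converse_rtranclE)
  then have "(v, u) \<in> parcs G"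
    using connected_graph_facts(3)[OF assms(1)] by (auto simp: symcl_def)
  then show thesis ..
qed

lemma LD_number_le: "LD_code G S \<Longrightarrow> LD_number G \<le> card S"
  unfolding LD_number_def by (rule Least_le) blast

lemma minimum_LD_code_exists:
  assumes "connected_graph G"
  obtains S where "minimum_LD_code G S"
proof -
  have "LD_code G (pverts G)"
    using connected_graph_facts(2)[OF assms] by (simp add: LD_code_def)
  then have "\<exists>m S. LD_code G S \<and> card S = m"
    by blast
  then have "\<exists>S. LD_code G S \<and> card S = LD_number G"
    unfolding LD_number_def by (rule LeastI_ex)
  then show thesis
    using that by (auto simp: minimum_LD_code_def)
qed

section \<open>Min-forced vertices occur twice as directions\<close>

text \<open>
  Let \<open>t\<close> be the trace on \<open>S - {v}\<close>.  If \<open>v\<close> were the direction of at most one edge, then at most one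
  pair of (possibly artificial) vertices outside \<open>S\<close> would have equal \<open>t\<close>; every other collision
  involves \<open>v\<close> itself, which now lies outside the code.  Exchanging \<open>v\<close> for \<open>u\<close> fails only if some
  collision survives.  Suppose there is a colliding pair \<open>a\<close>, \<open>b\<close>, where \<open>a\<close> is the one adjacent to
  \<open>v\<close>.  Exchanging \<open>v\<close> for \<open>a\<close> fails only because of a real vertex \<open>x\<close> that collides with \<open>v\<close> and is
  adjacent to \<open>a\<close>.  If \<open>x = b\<close>, the exchange for \<open>b\<close> succeeds, because \<open>b\<close> is adjacent to \<open>a\<close> but not
  to \<open>v\<close>.  If \<open>x \<noteq> b\<close>, the exchange for \<open>x\<close> fails only if \<open>x\<close> is adjacent to \<open>b\<close> as well, and then the
  exchange for \<open>b\<close> succeeds, because \<open>b\<close> is adjacent to \<open>x\<close> but not to \<open>v\<close>.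
  Without such a pair, the only collision is that of \<open>v\<close> with a single vertex \<open>x\<close>: exchanging \<open>v\<close> for
  \<open>x\<close> works if \<open>x\<close> is real, and otherwise any neighbour of \<open>v\<close> repairs domination.
\<close>

lemma min_forced_direction_twice:
  assumes G: "connected_graph G" "card (pverts G) \<ge> 2"
    and S: "minimum_LD_code G S" and v: "v \<in> min_forced G"
  shows "2 \<le> card (link ((\<lambda>p. S \<inter> nbrs G p) ` outside G S) v)"
proof (rule ccontr)
  define F where "F = (\<lambda>p. S \<inter> nbrs G p) ` outside G S"
  define t where "t p = (S - {v}) \<inter> nbrs G p" for p
  let ?U = "outside G S"
  note fin = connected_graph_facts(1)[OF G(1)] and ne = connected_graph_facts(2)[OF G(1)]
    and sym = connected_graph_facts(3)[OF G(1)] and irrefl = connected_graph_facts(4)[OF G(1)]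
  assume "\<not> 2 \<le> card (link ((\<lambda>p. S \<inter> nbrs G p) ` outside G S) v)"
  then have "card (link F v) \<le> Suc 0"
    by (simp add: F_def)
  then have link_unique: "A = B" if "A \<in> link F v" "B \<in> link F v" for A B
    using that fin by (subst (asm) card_le_Suc0_iff_eq)
      (auto simp: F_def intro!: finite_link finite_outside)
  have SV: "S \<subseteq> pverts G" and inj: "inj_on (\<lambda>p. S \<inter> nbrs G p) ?U"
    using S LD_code_iff_inj_on[OF ne] by (auto simp: minimum_LD_code_def)
  have vS: "v \<in> S"
    using S v by (auto simp: min_forced_def)
  have vU: "Some v \<notin> ?U"
    using vS by (auto simp: outside_def)
  have out: "outside G (S - {v}) = insert (Some v) ?U"
    using vS SV by (auto simp: outside_def)
  have differ: "v \<in> nbrs G p \<longleftrightarrow> v \<notin> nbrs G q"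
    if "p \<in> ?U" "q \<in> ?U" "p \<noteq> q" "t p = t q" for p q
  proof (rule ccontr)
    assume "\<not> ?thesis"
    then have "S \<inter> nbrs G p = S \<inter> nbrs G q"
      using that(4) unfolding t_def by blast
    then show False
      using inj that by (auto dest: inj_onD)
  qed
  have in_link: "t p \<in> link F v" if pq: "p \<in> ?U" "q \<in> ?U" "p \<noteq> q" "t p = t q" for p q
  proof -
    obtain a b where ab: "a \<in> ?U" "b \<in> ?U" "v \<in> nbrs G a" "v \<notin> nbrs G b" "t a = t p" "t b = t p"
      using differ[OF pq] pq by metis
    have "t p = S \<inter> nbrs G b" "insert v (t p) = S \<inter> nbrs G a" "v \<notin> t p"
      using ab vS unfolding t_def by blast+
    then show ?thesis
      using ab by (auto simp: link_def F_def)
  qed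
  have pair_unique: "{p, q} = {p', q'}"
    if "p \<in> ?U" "q \<in> ?U" "p \<noteq> q" "t p = t q" "p' \<in> ?U" "q' \<in> ?U" "p' \<noteq> q'" "t p' = t q'"
    for p q p' q'
  proof -
    have "t p = t p'"
      using in_link that link_unique by blast
    then show ?thesis
      using that differ[of p q] differ[of p p'] differ[of p q'] differ[of q p'] differ[of q q']
        differ[of p' q']
      unfolding doubleton_eq_iff by metis
  qed
  \<comment> \<open>Exchanging \<open>v\<close> for \<open>u\<close> keeps the size, so the result is not an LD-code: some pair collides on
    \<open>S - {v}\<close> and is not told apart by \<open>u\<close>.\<close>
  have swap: "\<exists>p q. p \<in> insert (Some v) ?U - {Some u} \<and> q \<in> insert (Some v) ?U - {Some u} \<and>
      p \<noteq> q \<and> t p = t q \<and> (u \<in> nbrs G p \<longleftrightarrow> u \<in> nbrs G q)" if u: "Some u \<in> ?U" for u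
  proof -
    define T where "T = insert u (S - {v})"
    have uT: "u \<in> pverts G" "u \<notin> S"
      using u by (auto simp: outside_def)
    have "card T = Suc (card (S - {v}))"
      using uT finite_subset[OF SV fin] by (simp add: T_def)
    then have "card T = card S"
      using card_Suc_Diff1[OF finite_subset[OF SV fin] vS] by simp
    moreover have "v \<notin> T"
      using uT vS by (auto simp: T_def)
    ultimately have "\<not> LD_code G T"
      using v S by (auto simp: min_forced_def minimum_LD_code_def)
    then have "\<not> inj_on (\<lambda>p. T \<inter> nbrs G p) (outside G T)"
      using LD_code_iff_inj_on[OF ne] uT SV by (auto simp: T_def)
    moreover have "outside G T = insert (Some v) ?U - {Some u}"
      using vS SV uT by (auto simp: outside_def T_def)
    moreover have "t p = t q \<and> (u \<in> nbrs G p \<longleftrightarrow> u \<in> nbrs G q)"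
      if "T \<inter> nbrs G p = T \<inter> nbrs G q" for p q
      using that uT vS unfolding t_def T_def by blast
    ultimately show ?thesis
      unfolding inj_on_def by metis
  qed
  \<comment> \<open>When \<open>u\<close> resolves the collisions among vertices outside \<open>S\<close>, the surviving one involves \<open>v\<close>.\<close>
  have swap': "\<exists>y \<in> ?U. y \<noteq> Some u \<and> t y = t (Some v) \<and> (u \<in> nbrs G y \<longleftrightarrow> (v, u) \<in> parcs G)"
    if u: "Some u \<in> ?U"
      and sep: "\<And>p q. p \<in> ?U \<Longrightarrow> q \<in> ?U \<Longrightarrow> p \<noteq> q \<Longrightarrow> t p = t q \<Longrightarrow>
        p = Some u \<or> q = Some u \<or> (u \<in> nbrs G p \<longleftrightarrow> u \<notin> nbrs G q)" for u
  proof -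
    obtain p q where pq: "p \<in> insert (Some v) ?U" "q \<in> insert (Some v) ?U" "p \<noteq> Some u"
        "q \<noteq> Some u" "p \<noteq> q" "t p = t q" "u \<in> nbrs G p \<longleftrightarrow> u \<in> nbrs G q"
      using swap[OF u] by auto
    then have "p = Some v \<or> q = Some v"
      using sep[of p q] by auto
    then consider "p = Some v" "q \<in> ?U" | "q = Some v" "p \<in> ?U"
      using pq by auto
    then show ?thesis
    proof cases
      case 1
      then show ?thesis using pq by (intro bexI[of _ q]) auto
    next
      case 2
      then show ?thesis using pq by (intro bexI[of _ p]) auto
    qed
  qed
  show False
  proof (cases "\<exists>p \<in> ?U. \<exists>q \<in> ?U. p \<noteq> q \<and> t p = t q")
    case True
    then obtain a' b where ab': "a' \<in> ?U" "b \<in> ?U" "a' \<noteq> b" "t a' = t b"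
        "v \<in> nbrs G a'" "v \<notin> nbrs G b"
      using differ by metis
    then obtain a where a': "a' = Some a"
      by (cases a') auto
    note ab = ab'[unfolded a']
    have only_pair: "p = Some a \<and> q = b \<or> p = b \<and> q = Some a"
      if "p \<in> ?U" "q \<in> ?U" "p \<noteq> q" "t p = t q" for p q
      using pair_unique[OF that ab(1,2,3,4)] by (auto simp: doubleton_eq_iff)
    have va: "(v, a) \<in> parcs G"
      using ab(5) sym[of v a] by simp
    have hit: "\<exists>y \<in> ?U. y \<noteq> Some u \<and> t y = t (Some v) \<and> (u \<in> nbrs G y \<longleftrightarrow> (v, u) \<in> parcs G)"
      if "Some u \<in> ?U" "Some u = Some a \<or> Some u = b" for u
      using that(2) only_pair by (intro swap'[OF that(1)]) metis
    obtain x' where x': "x' \<in> ?U" "x' \<noteq> Some a" "t x' = t (Some v)" "a \<in> nbrs G x'"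
      using hit[of a] ab(1) va by auto
    then obtain x where x: "x' = Some x"
      by (cases x') auto
    have ax: "(a, x) \<in> parcs G"
      using x'(4) x sym[of a x] by simp
    show False
    proof (cases "b = Some x")
      case True
      obtain y where y: "y \<in> ?U" "y \<noteq> Some x" "t y = t (Some v)"
          "x \<in> nbrs G y \<longleftrightarrow> (v, x) \<in> parcs G"
        using hit[of x] True ab(2) by auto
      then have "y = Some a"
        using only_pair[of y "Some x"] x' x True by auto
      then show False
        using y(4) ax ab(6) True sym[of v x] by simp
    next
      case False
      \<comment> \<open>Any other \<open>y\<close> colliding with \<open>v\<close> would form with \<open>x\<close> a second colliding pair.\<close>
      have same: "y = x'" if "y \<in> ?U" "t y = t (Some v)" for y
        using only_pair[of y x'] that x' x False by auto
      have "x \<in> nbrs G (Some a) \<longleftrightarrow> x \<in> nbrs G b"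
      proof (rule ccontr)
        assume "\<not> ?thesis"
        then have "\<exists>y \<in> ?U. y \<noteq> Some x \<and> t y = t (Some v)"
          using swap'[of x] x'(1) x only_pair by metis
        then show False
          using same x by auto
      qed
      then have xb: "x \<in> nbrs G b"
        using ax by simp
      then obtain c where c: "b = Some c"
        by (cases b) auto
      have "\<exists>y \<in> ?U. t y = t (Some v) \<and> (c \<in> nbrs G y \<longleftrightarrow> (v, c) \<in> parcs G)"
        using hit[of c] ab(2) c by auto
      then have "c \<in> nbrs G x' \<longleftrightarrow> (v, c) \<in> parcs G"
        using same by metis
      then show False
        using xb c x ab(6) sym[of v c] sym[of x c] by simp
    qed
  next
    case False
    then have no: "p = q" if "p \<in> ?U" "q \<in> ?U" "t p = t q" for p q
      using that by metis
    \<comment> \<open>Minimality of \<open>S\<close> provides at least one collision, and it has to involve \<open>v\<close>.\<close>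
    have "card (S - {v}) < card S"
      using vS finite_subset[OF SV fin] by (intro psubset_card_mono) auto
    then have "\<not> LD_code G (S - {v})"
      using LD_number_le[of G "S - {v}"] S by (auto simp: minimum_LD_code_def)
    then have "\<not> inj_on t (insert (Some v) ?U)"
      using SV LD_code_iff_inj_on[OF ne, of "S - {v}"] by (auto simp: out t_def[abs_def])
    moreover have "inj_on t ?U"
      using no by (auto intro: inj_onI)
    ultimately have "t (Some v) \<in> t ` ?U"
      using vU by simp
    then obtain x where x: "x \<in> ?U" "t x = t (Some v)"
      by auto
    have same: "y = x" if "y \<in> ?U" "t y = t (Some v)" for y
      using no[of y x] that x by simp
    have hit: "(u \<in> nbrs G x \<longleftrightarrow> (v, u) \<in> parcs G) \<and> x \<noteq> Some u" if "Some u \<in> ?U" for u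
      using swap'[OF that] no same by metis
    show False
    proof (cases x)
      case (Some u)
      then show False
        using hit[of u] x by simp
    next
      case None
      obtain u where u: "(v, u) \<in> parcs G"
        using connected_graph_obtains_neighbour[OF G] vS SV by auto
      have "t (Some v) = {}"
        using x None by (simp add: t_def)
      then have "u \<notin> S"
        using u irrefl[of v] by (auto simp: t_def)
      then have "Some u \<in> ?U"
        using u connected_graph_facts(5)[OF G(1)] by (auto simp: outside_def)
      then show False
        using hit[of u] None u by simp
    qed
  qed
qed

section \<open>The bound on the number of min-forced vertices\<close>

lemma min_forced_bound:
  assumes G: "connected_graph G" "card (pverts G) \<ge> 2"
  shows "3 * card (min_forced G) + 2 * LD_number G \<le> 2 * card (pverts G)"
    and "card (min_forced G) \<le> LD_number G"
proof -
  obtain S where S: "minimum_LD_code G S"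
    using minimum_LD_code_exists[OF G(1)] .
  note fin = connected_graph_facts(1)[OF G(1)] and ne = connected_graph_facts(2)[OF G(1)]
  have SV: "S \<subseteq> pverts G" and inj: "inj_on (\<lambda>p. S \<inter> nbrs G p) (outside G S)"
    and cardS: "card S = LD_number G"
    using S LD_code_iff_inj_on[OF ne] by (auto simp: minimum_LD_code_def)
  have sub: "min_forced G \<subseteq> S"
    using S by (auto simp: min_forced_def)
  have finS: "finite S"
    using SV fin by (rule finite_subset)
  show "card (min_forced G) \<le> LD_number G"
    using card_mono[OF finS sub] cardS by simp
  define F where "F = (\<lambda>p. S \<inter> nbrs G p) ` outside G S"
  have "card F = card (pverts G) - card S + 1"
    using inj fin SV by (simp add: F_def card_image card_outside)
  moreover have "3 * card (min_forced G) + 2 \<le> 2 * card F"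
  proof -
    have "2 \<le> card (link F w)" if "w \<in> min_forced G" for w
      using min_forced_direction_twice[OF G S that] by (simp add: F_def)
    moreover have "finite F" "F \<noteq> {}"
      using finite_outside[OF fin] by (simp_all add: F_def outside_def)
    ultimately show ?thesis
      using card_single_double_directions[of "{}" "min_forced G" F] finite_subset[OF sub finS]
      by simp
  qed
  moreover have "card S \<le> card (pverts G)"
    using SV fin by (intro card_mono)
  ultimately show "3 * card (min_forced G) + 2 * LD_number G \<le> 2 * card (pverts G)"
    using cardS by simp
qed

section \<open>The path on five vertices\<close>

definition path5 :: "nat pair_pre_digraph" where
  "path5 = \<lparr> pverts = {0, 1, 2, 3, 4},
     parcs = {(0, 1), (1, 0), (1, 2), (2, 1), (2, 3), (3, 2), (3, 4), (4, 3)} \<rparr>"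

lemma connected_graph_path5: "connected_graph path5"
proof -
  have pg: "pair_graph path5"
    by unfold_locales (auto simp: path5_def symmetric_def sym_def arcs_ends_def arc_to_ends_def)
  let ?E = "(parcs path5)\<^sup>s"
  have step: "(a, b) \<in> rtrancl_on (pverts path5) ?E" if "(a, b) \<in> parcs path5" for a b
    using that by (intro rtrancl_on_into_rtrancl_on[OF rtrancl_on_refl])
      (auto simp: path5_def symcl_def)
  \<comment> \<open>Every vertex is joined to the middle vertex 2.\<close>
  have to: "(2, a) \<in> rtrancl_on (pverts path5) ?E \<and> (a, 2) \<in> rtrancl_on (pverts path5) ?E"
    if "a \<in> pverts path5" for a
  proof -
    have 0: "(2, 2) \<in> rtrancl_on (pverts path5) ?E"
      by (rule rtrancl_on_refl) (simp add: path5_def)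
    have 1: "(2, 1) \<in> rtrancl_on (pverts path5) ?E" "(1, 0) \<in> rtrancl_on (pverts path5) ?E"
      "(2, 3) \<in> rtrancl_on (pverts path5) ?E" "(3, 4) \<in> rtrancl_on (pverts path5) ?E"
      "(1, 2) \<in> rtrancl_on (pverts path5) ?E" "(0, 1) \<in> rtrancl_on (pverts path5) ?E"
      "(3, 2) \<in> rtrancl_on (pverts path5) ?E" "(4, 3) \<in> rtrancl_on (pverts path5) ?E"
      by (rule step, simp add: path5_def)+
    have "a \<in> {0, 1, 2, 3, 4}"
      using that by (simp add: path5_def)
    then show ?thesis
      using 0 1 by (auto intro: rtrancl_on_trans)
  qed
  then show ?thesis
    using pg unfolding connected_graph_iff
  proof (intro conjI ballI)
    show "pverts path5 \<noteq> {}"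
      by (simp add: path5_def)
  next
    fix a b assume "a \<in> pverts path5" "b \<in> pverts path5"
    then show "(a, b) \<in> rtrancl_on (pverts path5) ?E"
      using to rtrancl_on_trans by metis
  qed
qed

lemma closed_nbhd_path5:
  "closed_nbhd path5 0 = {0, 1}" "closed_nbhd path5 1 = {0, 1, 2}"
  "closed_nbhd path5 2 = {1, 2, 3}" "closed_nbhd path5 3 = {2, 3, 4}"
  "closed_nbhd path5 4 = {3, 4}"
  by (auto simp: closed_nbhd_def path5_def)

lemma path5_LD_code: "LD_code path5 {1, 3}"
proof -
  have "pverts path5 - {1, 3} = {0, 2, 4}"
    by (auto simp: path5_def)
  moreover have "I_set path5 {1, 3} 0 = {1}" "I_set path5 {1, 3} 2 = {1, 3}"
    "I_set path5 {1, 3} 4 = {3}"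
    unfolding I_set_def closed_nbhd_path5 by auto
  moreover have "{1, 3} \<subseteq> pverts path5"
    by (simp add: path5_def)
  ultimately show ?thesis
    unfolding LD_code_def by (simp add: doubleton_eq_iff)
qed

text \<open>
  Dominating the two ends requires one of \<open>0, 1\<close> and one of \<open>3, 4\<close>.  The choice \<open>{0, 4}\<close> leaves \<open>2\<close>
  undominated, and the two mixed choices give \<open>2\<close> the same trace as an end.
\<close>

lemma path5_LD_code_unique:
  assumes "LD_code path5 S" "card S \<le> 2"
  shows "S = {1, 3}"
proof -
  have SV: "S \<subseteq> {0, 1, 2, 3, 4}"
    and sep: "\<And>x y. x \<in> {0, 1, 2, 3, 4} - S \<Longrightarrow> y \<in> {0, 1, 2, 3, 4} - S \<Longrightarrow> x \<noteq> y \<Longrightarrow>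
       I_set path5 S x \<noteq> I_set path5 S y"
    and dom: "\<And>x. x \<in> {0, 1, 2, 3, 4} - S \<Longrightarrow> I_set path5 S x \<noteq> {}"
    using assms(1) by (auto simp: LD_code_def path5_def)
  note N = closed_nbhd_path5
  obtain x where x: "x \<in> S" "x = 0 \<or> x = 1"
    using dom[of 0] N by (auto simp: I_set_def)
  obtain y where y: "y \<in> S" "y = 3 \<or> y = 4"
    using dom[of 4] N by (auto simp: I_set_def)
  have "card {x, y} = 2"
    using x y by auto
  then have S: "S = {x, y}"
    using x y assms(2) finite_subset[OF SV] by (intro card_seteq[symmetric]) auto
  show ?thesis
    using x(2) y(2) S dom[of 2] sep[of 0 2] sep[of 2 4] N by (auto simp: I_set_def)
qed

lemma path5_LD_number: "LD_number path5 = 2"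
proof -
  have le: "LD_number path5 \<le> 2"
    using LD_number_le[OF path5_LD_code] by simp
  obtain S where S: "LD_code path5 S" "card S = LD_number path5"
    using minimum_LD_code_exists[OF connected_graph_path5] unfolding minimum_LD_code_def by metis
  then have "S = {1, 3}"
    using le by (intro path5_LD_code_unique) simp_all
  then show ?thesis
    using S(2) by simp
qed

lemma path5_min_forced: "min_forced path5 = {1, 3}"
proof -
  have "minimum_LD_code path5 S \<longleftrightarrow> S = {1, 3}" for S
  proof
    assume "minimum_LD_code path5 S"
    then show "S = {1, 3}"
      by (intro path5_LD_code_unique) (simp_all add: minimum_LD_code_def path5_LD_number)
  next
    assume "S = {1, 3}"
    then show "minimum_LD_code path5 S"
      using path5_LD_code by (simp add: minimum_LD_code_def path5_LD_number)
  qed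
  then have "min_forced path5 = {v \<in> pverts path5. v \<in> {1, 3}}"
    by (simp add: min_forced_def)
  then show ?thesis
    by (auto simp: path5_def)
qed

lemma card_path5: "card (pverts path5) = 5"
  by (simp add: path5_def)

lemma forced_ratio_le:
  assumes "connected_graph G" "card (pverts G) \<ge> 2"
  shows "forced_ratio G \<le> 2 / 5"
  using min_forced_bound[OF assms] assms(2) by (simp add: forced_ratio_def divide_simps)

theorem corollary3p14:
  shows
    "(\<forall>(G :: 'a pair_pre_digraph) (n :: nat) (k :: nat).
        connected_graph G \<and> n = card (pverts G) \<and> n \<ge> 2 \<and>
        k = card (min_forced G) \<and> k \<ge> 1 \<longrightarrow>
          real k \<le> 2 / 3 * (real n - real (LD_number G)) \<and>
          real k \<le> 2 / 5 * real n)
     \<and>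
     (\<exists>(G :: nat pair_pre_digraph) (n :: nat) (k :: nat).
        connected_graph G \<and> n = card (pverts G) \<and> n \<ge> 2 \<and>
        k = card (min_forced G) \<and> k \<ge> 1 \<and>
          real k = 2 / 3 * (real n - real (LD_number G)) \<and>
          real k = 2 / 5 * real n)
     \<and>
     (\<forall>G :: 'a pair_pre_digraph.
        connected_graph G \<and> card (pverts G) \<ge> 2 \<longrightarrow> forced_ratio G \<le> 2 / 5)
     \<and>
     (let R = {forced_ratio G | G :: nat pair_pre_digraph.
                 connected_graph G \<and> card (pverts G) \<ge> 2}
      in 2 / 5 \<in> R \<and> (\<forall>r \<in> R. r \<le> 2 / 5))"
proof -
  have bounds: "real k \<le> 2 / 3 * (real n - real (LD_number G)) \<and> real k \<le> 2 / 5 * real n"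
    if "connected_graph G \<and> n = card (pverts G) \<and> n \<ge> 2 \<and> k = card (min_forced G) \<and> k \<ge> 1"
    for G :: "'a pair_pre_digraph" and n k
    using min_forced_bound[of G] that by simp
  have tight: "connected_graph path5 \<and> (5::nat) = card (pverts path5) \<and> (5::nat) \<ge> 2 \<and>
      (2::nat) = card (min_forced path5) \<and> (2::nat) \<ge> 1 \<and>
      real 2 = 2 / 3 * (real 5 - real (LD_number path5)) \<and> real 2 = 2 / 5 * real 5"
    by (simp add: connected_graph_path5 card_path5 path5_min_forced path5_LD_number)
  have "forced_ratio path5 = 2 / 5"
    by (simp add: forced_ratio_def card_path5 path5_min_forced)
  then have attained: "2 / 5 \<in> {forced_ratio G | G :: nat pair_pre_digraph.
      connected_graph G \<and> card (pverts G) \<ge> 2}"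
    by (intro CollectI exI[of _ path5]) (simp add: connected_graph_path5 card_path5)
  show ?thesis
    unfolding Let_def
  proof (intro conjI)
    show "\<forall>(G :: 'a pair_pre_digraph) n k.
        connected_graph G \<and> n = card (pverts G) \<and> n \<ge> 2 \<and>
        k = card (min_forced G) \<and> k \<ge> 1 \<longrightarrow>
          real k \<le> 2 / 3 * (real n - real (LD_number G)) \<and> real k \<le> 2 / 5 * real n"
      by (intro allI impI bounds)
    show "\<exists>(G :: nat pair_pre_digraph) n k.
        connected_graph G \<and> n = card (pverts G) \<and> n \<ge> 2 \<and>
        k = card (min_forced G) \<and> k \<ge> 1 \<and>
          real k = 2 / 3 * (real n - real (LD_number G)) \<and> real k = 2 / 5 * real n"
      by (intro exI) (rule tight)
    show "\<forall>G :: 'a pair_pre_digraph.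
        connected_graph G \<and> card (pverts G) \<ge> 2 \<longrightarrow> forced_ratio G \<le> 2 / 5"
      using forced_ratio_le by metis
    show "2 / 5 \<in> {forced_ratio G | G :: nat pair_pre_digraph.
        connected_graph G \<and> card (pverts G) \<ge> 2}"
      by (rule attained)
    show "\<forall>r \<in> {forced_ratio G | G :: nat pair_pre_digraph.
        connected_graph G \<and> card (pverts G) \<ge> 2}. r \<le> 2 / 5"
      by (clarify, rule forced_ratio_le)
  qed
qed

end
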